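(* Define $v:=\hat d-\hat F(u)\in\mathbb{R}^N$. If the random vector $r$ has components that are $b$-subgaussian for some $b\ge 1/\sqrt2$, then the RMA error $|J_n(u;r)-J(u)|$ has a large deviation rate bounded below by $c\,\dfrac{\delta^2}{2\theta^2}$ for $\theta=\|v\|^2/\sqrt2$ and some $0<c<\dfrac{1}{8b^4}$.
   Context: Let $\hat d\in\mathbb{R}^N$ be a (noise-scaled) data vector, $\hat F:\mathbb{R}^m\to\mathbb{R}^N$ a (noise-scaled) parameter-to-observable map, $u_0\in\mathbb{R}^m$ a prior mean, $\|\cdot\|$ the Euclidean norm and $\|\cdot\|_C$ the norm weighted by the inverse square root of the prior covariance. For a given parameter $u\in\mathbb{R}^m$ the cost is $$J(u)=\tfrac12\|\hat d-\hat F(u)\|^2+\tfrac12\|u-u_0\|_C^2 .$$ Let $r$ be a random vector in $\mathbb{R}^N$ whose components are i.i.d. with mean $0$ and variance $1$, and let $r_1,\dots,r_n$ be i.i.d. draws of $r$. The randomized misfit approach (RMA) replaces $J$ by $$J_n(u;r)=\frac1{2n}\sum_{j=1}^n\left[r_j^\top(\hat d-\hat F(u))\right]^2+\tfrac12\|u-u_0\|_C^2 .$$ The RMA error has large deviation rate $I(\delta)$ if, for $\delta>0$, $$\mathbb{P}\left[\,|J_n(u;r)-J(u)|>\tfrac{\delta}{2}\right]\le e^{-nI(\delta)}.$$ A real-valued random variable $X$ is $b$-subgaussian ($b>0$) if $\mathbb{E}[e^{tX}]\le e^{b^2t^2/2}$ for all $t\in\mathbb{R}$.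
   Formalization: The bound P ≤ e^{-nI(δ)} is required only for all sufficiently large n (for every n it is false), and c may depend on an arbitrary upper bound κ for δ/θ, the lower bound on I being claimed for δ ≤ κθ (one c for all δ fails for Gaussian r). *)

theory Defs
  imports "HOL-Probability.Probability"
begin

definition spd :: "real ^ 'n ^ 'n \<Rightarrow> bool" where
  "spd A \<longleftrightarrow> transpose A = A \<and> (\<forall>x. x \<noteq> 0 \<longrightarrow> x \<bullet> (A *v x) > 0)"

text \<open>For symmetric positive definite \<open>C\<close> the matrix \<open>C\<^bsup>-1/2\<^esup>\<close> is the unique
  symmetric positive definite square root of the inverse of \<open>C\<close>.\<close>

definition inv_sqrt :: "real ^ 'n ^ 'n \<Rightarrow> real ^ 'n ^ 'n" where
  "inv_sqrt C = (THE S. spd S \<and> S ** S = matrix_inv C)"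

definition weighted_norm :: "real ^ 'n ^ 'n \<Rightarrow> real ^ 'n \<Rightarrow> real" where
  "weighted_norm C x = norm (inv_sqrt C *v x)"

definition cost ::
  "real ^ 'N \<Rightarrow> (real ^ 'm \<Rightarrow> real ^ 'N) \<Rightarrow> real ^ 'm \<Rightarrow> real ^ 'm ^ 'm \<Rightarrow> real ^ 'm \<Rightarrow> real" where
  "cost d F u\<^sub>0 C u = (norm (d - F u))\<^sup>2 / 2 + (weighted_norm C (u - u\<^sub>0))\<^sup>2 / 2"

definition rma_cost ::
  "real ^ 'N \<Rightarrow> (real ^ 'm \<Rightarrow> real ^ 'N) \<Rightarrow> real ^ 'm \<Rightarrow> real ^ 'm ^ 'm \<Rightarrow>
   nat \<Rightarrow> (nat \<Rightarrow> real ^ 'N) \<Rightarrow> real ^ 'm \<Rightarrow> real" where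
  "rma_cost d F u\<^sub>0 C n \<rho> u =
     1 / (2 * real n) * (\<Sum>j=1..n. (\<rho> j \<bullet> (d - F u))\<^sup>2) + (weighted_norm C (u - u\<^sub>0))\<^sup>2 / 2"

context prob_space
begin

text \<open>Integrability is explicit because the Bochner integral of a non-integrable
  function is \<open>0\<close>.\<close>

definition subgaussian :: "real \<Rightarrow> ('a \<Rightarrow> real) \<Rightarrow> bool" where
  "subgaussian b X \<longleftrightarrow> 0 < b \<and> random_variable borel X \<and>
     (\<forall>t. integrable M (\<lambda>\<omega>. exp (t * X \<omega>)) \<and>
          expectation (\<lambda>\<omega>. exp (t * X \<omega>)) \<le> exp (b\<^sup>2 * t\<^sup>2 / 2))"

definition iid_standardized_components :: "('a \<Rightarrow> real ^ 'N) \<Rightarrow> bool" where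
  "iid_standardized_components r \<longleftrightarrow>
     random_variable borel r \<and>
     indep_vars (\<lambda>_. borel) (\<lambda>i \<omega>. r \<omega> $ i) UNIV \<and>
     (\<forall>i k. distr M borel (\<lambda>\<omega>. r \<omega> $ i) = distr M borel (\<lambda>\<omega>. r \<omega> $ k)) \<and>
     (\<forall>i. integrable M (\<lambda>\<omega>. r \<omega> $ i) \<and> expectation (\<lambda>\<omega>. r \<omega> $ i) = 0 \<and>
          integrable M (\<lambda>\<omega>. (r \<omega> $ i)\<^sup>2) \<and> variance (\<lambda>\<omega>. r \<omega> $ i) = 1)"

definition iid_draws :: "('a \<Rightarrow> real ^ 'N) \<Rightarrow> (nat \<Rightarrow> 'a \<Rightarrow> real ^ 'N) \<Rightarrow> bool" where
  "iid_draws r rs \<longleftrightarrow>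
     indep_vars (\<lambda>_. borel) rs {1..} \<and>
     (\<forall>j\<ge>1. distr M borel (rs j) = distr M borel r)"

text \<open>\<open>E n\<close> is the error with \<open>n\<close> draws. As usual for large deviations, the bound is
  asymptotic in \<open>n\<close>. No positive rate could be required at every \<open>n\<close>: in dimension one,
  if \<open>r\<close> takes the values \<open>0\<close>, \<open>sqrt 2\<close>, \<open>- sqrt 2\<close> with probabilities \<open>1/2\<close>, \<open>1/4\<close>, \<open>1/4\<close>
  (which is \<open>1\<close>-subgaussian with variance \<open>1\<close>), then \<open>\<bar>r\<^sup>2 - 1\<bar> = 1\<close> surely, so
  for \<open>n = 1\<close> and a unit misfit the error is surely \<open>1/2\<close>.\<close>

definition has_large_deviation_rate :: "(nat \<Rightarrow> 'a \<Rightarrow> real) \<Rightarrow> (real \<Rightarrow> real) \<Rightarrow> bool" where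
  "has_large_deviation_rate E I \<longleftrightarrow>
     (\<forall>\<delta>>0. \<forall>\<^sub>F n in sequentially.
        prob {\<omega> \<in> space M. E n \<omega> > \<delta> / 2} \<le> exp (- (real n * I \<delta>)))"

end

end

theory Submission
  imports Defs
begin

text \<open>
  Write \<open>v\<close> for the misfit. The prior terms of the two costs cancel, so for \<open>v \<noteq> 0\<close> the error
  is \<open>\<parallel>v\<parallel>\<^sup>2 / 2\<close> times the absolute mean of \<open>n\<close> independent copies of \<open>Y = X\<^sup>2 - 1\<close>, where
  \<open>X = r \<bullet> v / \<parallel>v\<parallel>\<close> (\<open>rma_error_eq\<close>). As a unit combination of independent standardized
  \<open>b\<close>-subgaussian components, \<open>X\<close> is itself \<open>b\<close>-subgaussian and has second moment \<open>1\<close>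
  (\<open>subgaussian_linear_combination\<close>, \<open>expectation_square_linear_combination\<close>). The dimension
  and the law of \<open>r\<close> therefore enter only through \<open>b\<close>.

  Subgaussianity makes \<open>exp (X\<^sup>2 / (4 * b\<^sup>2))\<close> integrable, with a bound depending on \<open>b\<close> alone
  (\<open>subgaussian_square_exp\<close>). Since \<open>Y\<close> has mean \<open>0\<close>, a second-order expansion of the exponential
  then gives a quadratic bound \<open>exp (K * s\<^sup>2)\<close> on the moment generating function of \<open>Y\<close> for
  \<open>s\<close> near \<open>0\<close> (\<open>centred_square_mgf\<close>), and Chernoff's method bounds the probability that the
  mean exceeds \<open>x\<close> in absolute value by \<open>2 * exp (- n * \<eta> * x\<^sup>2 / 2)\<close>
  (\<open>chernoff_sum_two_sided\<close>).

  In these terms \<open>x = \<delta> / \<parallel>v\<parallel>\<^sup>2\<close> and \<open>\<delta>\<^sup>2 / (2 * \<theta>\<^sup>2) = x\<^sup>2\<close>, so the exponent has the required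
  form. The variable \<open>Y\<close> is only subexponential, which is why the quadratic rate is obtained on the
  bounded range \<open>x \<le> \<kappa> / sqrt 2\<close>: there one \<open>\<eta>\<close>, depending on \<open>b\<close> and \<open>\<kappa>\<close>, keeps the Chernoff
  parameter \<open>\<eta> * x\<close> inside the interval where the quadratic bound holds. Any \<open>c < \<eta> / 2\<close> then
  absorbs the factor \<open>2\<close> for large \<open>n\<close>. If \<open>v = 0\<close>, the range of \<open>\<delta>\<close> is empty.
\<close>

section \<open>Linear combinations of independent standardized variables\<close>

context prob_space
begin

text \<open>Independence turns the moment generating function of the sum into a product, in which the
  exponents \<open>b\<^sup>2 * (t * a i)\<^sup>2 / 2\<close> add up to \<open>b\<^sup>2 * t\<^sup>2 / 2\<close>.\<close>

lemma subgaussian_linear_combination: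
  fixes X :: "'i \<Rightarrow> 'a \<Rightarrow> real"
  assumes "finite I" and indep: "indep_vars (\<lambda>_. borel) X I"
    and sub: "\<And>i. i \<in> I \<Longrightarrow> subgaussian b (X i)"
    and unit: "(\<Sum>i\<in>I. (a i)\<^sup>2) = 1"
  shows "subgaussian b (\<lambda>\<omega>. \<Sum>i\<in>I. a i * X i \<omega>)"
proof -
  have "I \<noteq> {}" using unit by auto
  then have b: "b > 0" using sub by (auto simp: subgaussian_def)
  have [measurable]: "X i \<in> borel_measurable M" if "i \<in> I" for i
    using sub[OF that] by (simp add: subgaussian_def)
  have "integrable M (\<lambda>\<omega>. exp (t * (\<Sum>i\<in>I. a i * X i \<omega>)))
      \<and> expectation (\<lambda>\<omega>. exp (t * (\<Sum>i\<in>I. a i * X i \<omega>))) \<le> exp (b\<^sup>2 * t\<^sup>2 / 2)" for t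
  proof -
    have split: "exp (t * (\<Sum>i\<in>I. a i * X i \<omega>)) = (\<Prod>i\<in>I. exp ((t * a i) * X i \<omega>))" for \<omega>
      by (simp add: sum_distrib_left exp_sum \<open>finite I\<close> mult.assoc)
    have ind: "indep_vars (\<lambda>_. borel) (\<lambda>i \<omega>. exp ((t * a i) * X i \<omega>)) I"
      by (rule indep_vars_compose2[OF indep]) simp
    have int: "integrable M (\<lambda>\<omega>. exp ((t * a i) * X i \<omega>))" if "i \<in> I" for i
      using sub[OF that] by (simp add: subgaussian_def)
    have "expectation (\<lambda>\<omega>. \<Prod>i\<in>I. exp ((t * a i) * X i \<omega>))
        = (\<Prod>i\<in>I. expectation (\<lambda>\<omega>. exp ((t * a i) * X i \<omega>)))"
      by (rule indep_vars_lebesgue_integral[OF \<open>finite I\<close> ind int])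
    also have "\<dots> \<le> (\<Prod>i\<in>I. exp (b\<^sup>2 * (t * a i)\<^sup>2 / 2))"
      using sub by (intro prod_mono) (auto simp: subgaussian_def)
    also have "\<dots> = exp (\<Sum>i\<in>I. b\<^sup>2 * t\<^sup>2 / 2 * (a i)\<^sup>2)"
      by (simp add: exp_sum \<open>finite I\<close> power_mult_distrib mult_ac)
    also have "\<dots> = exp (b\<^sup>2 * t\<^sup>2 / 2)"
      by (simp only: sum_distrib_left[symmetric] unit mult_1_right)
    finally show ?thesis
      using indep_vars_integrable[OF \<open>finite I\<close> ind int] by (simp add: split)
  qed
  with b show ?thesis by (auto simp: subgaussian_def)
qed

text \<open>Only the diagonal of the expanded square survives: independence and mean \<open>0\<close> make the variables
  orthonormal.\<close>

lemma expectation_square_linear_combination: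
  fixes X :: "'i \<Rightarrow> 'a \<Rightarrow> real"
  assumes "finite I" and indep: "indep_vars (\<lambda>_. borel) X I"
    and int: "\<And>i. i \<in> I \<Longrightarrow> integrable M (X i)"
    and mean: "\<And>i. i \<in> I \<Longrightarrow> expectation (X i) = 0"
    and int2: "\<And>i. i \<in> I \<Longrightarrow> integrable M (\<lambda>\<omega>. (X i \<omega>)\<^sup>2)"
    and second: "\<And>i. i \<in> I \<Longrightarrow> expectation (\<lambda>\<omega>. (X i \<omega>)\<^sup>2) = 1"
  shows "expectation (\<lambda>\<omega>. (\<Sum>i\<in>I. a i * X i \<omega>)\<^sup>2) = (\<Sum>i\<in>I. (a i)\<^sup>2)"
proof -
  have cov: "integrable M (\<lambda>\<omega>. X i \<omega> * X k \<omega>)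
      \<and> expectation (\<lambda>\<omega>. X i \<omega> * X k \<omega>) = (if i = k then 1 else 0)"
    if "i \<in> I" "k \<in> I" for i k
  proof (cases "i = k")
    case True
    then show ?thesis
      using int2[OF that(1)] second[OF that(1)] by (simp add: power2_eq_square)
  next
    case False
    have sub: "indep_vars (\<lambda>_. borel) X {i, k}"
      by (rule indep_vars_subset[OF indep]) (use that in auto)
    have "integrable M (\<lambda>\<omega>. \<Prod>l\<in>{i,k}. X l \<omega>)"
      by (rule indep_vars_integrable[OF _ sub]) (use that int in auto)
    moreover have "expectation (\<lambda>\<omega>. \<Prod>l\<in>{i,k}. X l \<omega>) = (\<Prod>l\<in>{i,k}. expectation (X l))"
      by (rule indep_vars_lebesgue_integral[OF _ sub]) (use that int in auto)
    ultimately show ?thesis using False mean that by simp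
  qed
  have "expectation (\<lambda>\<omega>. (\<Sum>i\<in>I. a i * X i \<omega>)\<^sup>2)
      = expectation (\<lambda>\<omega>. \<Sum>i\<in>I. \<Sum>k\<in>I. (a i * a k) * (X i \<omega> * X k \<omega>))"
    by (simp add: power2_eq_square sum_product mult_ac)
  also have "\<dots> = (\<Sum>i\<in>I. \<Sum>k\<in>I. (a i * a k) * expectation (\<lambda>\<omega>. X i \<omega> * X k \<omega>))"
    using cov by (simp add: Bochner_Integration.integral_sum)
  also have "\<dots> = (\<Sum>i\<in>I. \<Sum>k\<in>I. if i = k then (a i)\<^sup>2 else 0)"
    using cov by (intro sum.cong refl) (auto simp: power2_eq_square)
  also have "\<dots> = (\<Sum>i\<in>I. (a i)\<^sup>2)"
    using \<open>finite I\<close> by simp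
  finally show ?thesis .
qed

end

section \<open>Exponential moments of the square of a subgaussian variable\<close>

text \<open>The sum over \<open>m\<close> is \<open>\<Sum>m. exp (- b\<^sup>2 * m\<^sup>2 / 2)\<close>, written as powers
  of a number below \<open>1\<close> so that comparison with a geometric series applies.\<close>

definition square_exp_const :: "real \<Rightarrow> real" where
  "square_exp_const b = 2 * exp (b\<^sup>2) * (\<Sum>m. exp (- (b\<^sup>2 / 2)) ^ (m\<^sup>2))"

lemma summable_power_square:
  fixes q :: real
  assumes "0 \<le> q" "q < 1"
  shows "summable (\<lambda>m. q ^ (m\<^sup>2))"
proof (rule summable_comparison_test')
  show "summable (\<lambda>m. q ^ m)" using assms by (simp add: summable_geometric)
  show "norm (q ^ (m\<^sup>2)) \<le> q ^ m" for m
    using assms by (auto intro!: power_decreasing simp: power2_eq_square abs_mult power_abs)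
qed

lemma le_suminf_ennreal:
  fixes f :: "nat \<Rightarrow> ennreal"
  shows "f m \<le> (\<Sum>m. f m)"
  using sum_le_suminf[OF summableI, of "{m}" f] by simp

text \<open>The function \<open>m \<mapsto> m * \<bar>x\<bar> - q * m\<^sup>2\<close> has maximum \<open>x\<^sup>2 / (4 * q)\<close> at \<open>m = \<bar>x\<bar> / (2 * q)\<close>, and
  rounding that point to an integer costs at most \<open>q\<close>. So, up to the factor \<open>exp q\<close>, the Gaussian
  growth \<open>exp (x\<^sup>2 / (4 * q))\<close> is dominated by a discrete Gaussian mixture of the exponentials
  \<open>exp (m * x)\<close>, whose expectations a subgaussian hypothesis controls.\<close>

lemma exp_square_le_lattice_term:
  fixes x q :: real
  assumes "q > 0"
  shows "\<exists>m::nat. exp (x\<^sup>2 / (4 * q))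
    \<le> exp q * ((exp (real m * x) + exp (- real m * x)) * exp (- q * (real m)\<^sup>2))"
proof
  define m where "m = nat \<lfloor>\<bar>x\<bar> / (2 * q)\<rfloor>"
  let ?z = "\<bar>x\<bar> / (2 * q)"
  have z: "?z \<ge> 0" using assms by simp
  have "\<bar>?z - real m\<bar> \<le> 1"
    using z unfolding m_def by (simp add: le_nat_floor abs_le_iff) linarith
  then have "(?z - real m)\<^sup>2 \<le> 1"
    by (simp add: abs_square_le_1)
  then have "q * (?z - real m)\<^sup>2 \<le> q" using assms by simp
  moreover have "q * (?z - real m)\<^sup>2 = x\<^sup>2 / (4 * q) - real m * \<bar>x\<bar> + q * (real m)\<^sup>2"
    using assms by (simp add: power2_eq_square field_simps)
  ultimately have "x\<^sup>2 / (4 * q) \<le> q + real m * \<bar>x\<bar> - q * (real m)\<^sup>2" by linarith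
  then have "exp (x\<^sup>2 / (4 * q)) \<le> exp (q + real m * \<bar>x\<bar> - q * (real m)\<^sup>2)" by simp
  also have "\<dots> = exp q * (exp (real m * \<bar>x\<bar>) * exp (- q * (real m)\<^sup>2))"
    by (simp add: exp_add[symmetric])
  also have "\<dots> \<le> exp q * ((exp (real m * x) + exp (- real m * x)) * exp (- q * (real m)\<^sup>2))"
    by (intro mult_left_mono mult_right_mono) (auto simp: abs_if)
  finally show "exp (x\<^sup>2 / (4 * q))
    \<le> exp q * ((exp (real m * x) + exp (- real m * x)) * exp (- q * (real m)\<^sup>2))" .
qed

text \<open>Apply the lattice domination with \<open>q = b\<^sup>2\<close> and integrate term by term. The \<open>m\<close>-th exponential has
  expectation at most \<open>exp (b\<^sup>2 * m\<^sup>2 / 2)\<close>, and its weight \<open>exp (- b\<^sup>2 * m\<^sup>2)\<close>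
  removes twice that exponent; hence the series converges.\<close>

lemma (in prob_space) subgaussian_square_exp:
  assumes "subgaussian b X"
  shows "integrable M (\<lambda>\<omega>. exp ((X \<omega>)\<^sup>2 / (4 * b\<^sup>2)))"
    and "expectation (\<lambda>\<omega>. exp ((X \<omega>)\<^sup>2 / (4 * b\<^sup>2))) \<le> square_exp_const b"
proof -
  have b: "b\<^sup>2 > 0" and [measurable]: "X \<in> borel_measurable M"
    and int: "\<And>t. integrable M (\<lambda>\<omega>. exp (t * X \<omega>))"
    and mgf: "\<And>t. expectation (\<lambda>\<omega>. exp (t * X \<omega>)) \<le> exp (b\<^sup>2 * t\<^sup>2 / 2)"
    using assms by (auto simp: subgaussian_def)
  let ?q = "exp (- (b\<^sup>2 / 2))"
  let ?g = "\<lambda>m \<omega>. exp (b\<^sup>2) *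
      ((exp (real m * X \<omega>) + exp (- real m * X \<omega>)) * exp (- b\<^sup>2 * (real m)\<^sup>2))"
  let ?h = "\<lambda>m::nat. 2 * exp (b\<^sup>2) * ?q ^ (m\<^sup>2)"
  have sm: "summable (\<lambda>m::nat. ?q ^ (m\<^sup>2))"
    using b by (intro summable_power_square) auto
  have nn: "square_exp_const b \<ge> 0"
    unfolding square_exp_const_def by (intro mult_nonneg_nonneg suminf_nonneg sm) auto
  have term_bound: "(\<integral>\<^sup>+\<omega>. ennreal (?g m \<omega>) \<partial>M) \<le> ennreal (?h m)" for m :: nat
  proof -
    have ig: "integrable M (?g m)"
      using int[of "real m"] int[of "- real m"] by auto
    have "(\<integral>\<^sup>+\<omega>. ennreal (?g m \<omega>) \<partial>M) = ennreal (expectation (?g m))"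
      by (rule nn_integral_eq_integral[OF ig]) (auto intro!: add_nonneg_nonneg)
    also have "expectation (?g m) = exp (b\<^sup>2) * ((expectation (\<lambda>\<omega>. exp (real m * X \<omega>))
        + expectation (\<lambda>\<omega>. exp (- real m * X \<omega>))) * exp (- b\<^sup>2 * (real m)\<^sup>2))"
      using int[of "real m"] int[of "- real m"] by simp
    also have "\<dots> \<le> exp (b\<^sup>2) * ((exp (b\<^sup>2 * (real m)\<^sup>2 / 2) + exp (b\<^sup>2 * (real m)\<^sup>2 / 2))
        * exp (- b\<^sup>2 * (real m)\<^sup>2))"
      using mgf[of "real m"] mgf[of "- real m"]
      by (intro mult_left_mono mult_right_mono add_mono) auto
    also have "\<dots> = 2 * exp (b\<^sup>2) * exp (b\<^sup>2 * (real m)\<^sup>2 / 2 + - b\<^sup>2 * (real m)\<^sup>2)"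
      unfolding exp_add by simp
    also have "b\<^sup>2 * (real m)\<^sup>2 / 2 + - b\<^sup>2 * (real m)\<^sup>2 = real (m\<^sup>2) * (- (b\<^sup>2 / 2))"
      by simp
    also have "2 * exp (b\<^sup>2) * exp \<dots> = ?h m"
      by (simp only: exp_of_nat_mult)
    finally show ?thesis by (auto intro: ennreal_leI)
  qed
  have "(\<integral>\<^sup>+\<omega>. ennreal (exp ((X \<omega>)\<^sup>2 / (4 * b\<^sup>2))) \<partial>M)
      \<le> (\<integral>\<^sup>+\<omega>. (\<Sum>m. ennreal (?g m \<omega>)) \<partial>M)"
  proof (rule nn_integral_mono)
    fix \<omega>
    obtain m :: nat where "exp ((X \<omega>)\<^sup>2 / (4 * b\<^sup>2)) \<le> ?g m \<omega>"
      using exp_square_le_lattice_term[OF b] by blast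
    then have "ennreal (exp ((X \<omega>)\<^sup>2 / (4 * b\<^sup>2))) \<le> ennreal (?g m \<omega>)" by (rule ennreal_leI)
    also have "\<dots> \<le> (\<Sum>m. ennreal (?g m \<omega>))"
      by (rule le_suminf_ennreal)
    finally show "ennreal (exp ((X \<omega>)\<^sup>2 / (4 * b\<^sup>2))) \<le> (\<Sum>m. ennreal (?g m \<omega>))" .
  qed
  also have "\<dots> = (\<Sum>m. \<integral>\<^sup>+\<omega>. ennreal (?g m \<omega>) \<partial>M)"
    by (rule nn_integral_suminf) simp
  also have "\<dots> \<le> (\<Sum>m. ennreal (?h m))"
    by (intro suminf_le term_bound summableI)
  also have "\<dots> = ennreal (\<Sum>m. ?h m)"
    by (rule suminf_ennreal2) (auto intro!: summable_mult sm)
  also have "(\<Sum>m. ?h m) = square_exp_const b"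
    unfolding square_exp_const_def by (rule suminf_mult[OF sm])
  finally have bound: "(\<integral>\<^sup>+\<omega>. ennreal (exp ((X \<omega>)\<^sup>2 / (4 * b\<^sup>2))) \<partial>M)
      \<le> ennreal (square_exp_const b)" .
  show integ: "integrable M (\<lambda>\<omega>. exp ((X \<omega>)\<^sup>2 / (4 * b\<^sup>2)))"
    using bound by (intro integrableI_bounded) (auto intro: le_less_trans)
  show "expectation (\<lambda>\<omega>. exp ((X \<omega>)\<^sup>2 / (4 * b\<^sup>2))) \<le> square_exp_const b"
    using bound nn nn_integral_eq_integral[OF integ] by simp
qed

text \<open>The remainder of the second-order expansion is at most \<open>s\<^sup>2 * (y\<^sup>2 / 2) * exp (t * \<bar>y\<bar>)\<close>. The factor
  \<open>y\<^sup>2 / 2\<close> is itself bounded by \<open>exp (t * \<bar>y\<bar>) / t\<^sup>2\<close>, so that a single exponential moment controls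
  the whole remainder.\<close>

lemma exp_le_quadratic_remainder:
  fixes s t y :: real
  assumes "\<bar>s\<bar> \<le> t" "t > 0"
  shows "exp (s * y) \<le> 1 + s * y + s\<^sup>2 / t\<^sup>2 * exp (2 * t * \<bar>y\<bar>)"
proof -
  obtain z where z: "\<bar>z\<bar> \<le> \<bar>s * y\<bar>"
    "exp (s * y) = (\<Sum>m<2. (s * y) ^ m / fact m) + exp z / fact 2 * (s * y) ^ 2"
    using Maclaurin_exp_le by blast
  have "z \<le> \<bar>s\<bar> * \<bar>y\<bar>" using z(1) by (simp add: abs_mult)
  also have "\<dots> \<le> t * \<bar>y\<bar>" using assms by (intro mult_right_mono) auto
  finally have ez: "exp z \<le> exp (t * \<bar>y\<bar>)" by simp
  have "(t * \<bar>y\<bar>)\<^sup>2 / 2 \<le> exp (t * \<bar>y\<bar>)"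
    using exp_lower_Taylor_quadratic[of "t * \<bar>y\<bar>"] mult_nonneg_nonneg[of t "\<bar>y\<bar>"] assms
    by linarith
  then have "y\<^sup>2 / 2 \<le> exp (t * \<bar>y\<bar>) / t\<^sup>2"
    using assms by (simp add: field_simps power_mult_distrib)
  then have "exp z * (y\<^sup>2 / 2) \<le> exp (t * \<bar>y\<bar>) * (exp (t * \<bar>y\<bar>) / t\<^sup>2)"
    by (intro mult_mono ez) auto
  also have "\<dots> = exp (2 * t * \<bar>y\<bar>) / t\<^sup>2"
    by (simp add: exp_add[symmetric])
  finally have "s\<^sup>2 * (exp z * (y\<^sup>2 / 2)) \<le> s\<^sup>2 * (exp (2 * t * \<bar>y\<bar>) / t\<^sup>2)"
    by (rule mult_left_mono) simp
  then show ?thesis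
    using z(2) by (simp add: numeral_2_eq_2 power_mult_distrib mult_ac)
qed

text \<open>With \<open>t = 1 / (8 * b\<^sup>2)\<close>, the half-width of the interval of admissible parameters \<open>s\<close> below, this
  is \<open>exp (2 * t) * square_exp_const b / t\<^sup>2\<close>.\<close>

definition mgf_rate :: "real \<Rightarrow> real" where
  "mgf_rate b = 64 * b ^ 4 * exp (1 / (4 * b\<^sup>2)) * square_exp_const b"

text \<open>The linear term of the expansion has expectation \<open>0\<close>. The exponential moment in the remainder is
  \<open>exp (2 * t * \<bar>X\<^sup>2 - 1\<bar>) \<le> exp (2 * t) * exp (2 * t * X\<^sup>2)\<close>, and \<open>t = 1 / (8 * b\<^sup>2)\<close> is chosen such
  that \<open>2 * t * X\<^sup>2 = X\<^sup>2 / (4 * b\<^sup>2)\<close>, the exponent already bounded.\<close>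

lemma (in prob_space) centred_square_mgf:
  assumes sub: "subgaussian b X" and second: "expectation (\<lambda>\<omega>. (X \<omega>)\<^sup>2) = 1"
    and s: "\<bar>s\<bar> \<le> 1 / (8 * b\<^sup>2)"
  shows "integrable M (\<lambda>\<omega>. exp (s * ((X \<omega>)\<^sup>2 - 1)))"
    and "expectation (\<lambda>\<omega>. exp (s * ((X \<omega>)\<^sup>2 - 1))) \<le> exp (mgf_rate b * s\<^sup>2)"
proof -
  have b: "b > 0" and [measurable]: "X \<in> borel_measurable M"
    using sub by (auto simp: subgaussian_def)
  define t where "t = 1 / (8 * b\<^sup>2)"
  have t: "t > 0" using b by (simp add: t_def)
  let ?Q = "\<lambda>\<omega>. exp ((X \<omega>)\<^sup>2 / (4 * b\<^sup>2))"
  note Q = subgaussian_square_exp[OF sub]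
  (* the integral of a non-integrable function would be 0, not 1 *)
  have int2: "integrable M (\<lambda>\<omega>. (X \<omega>)\<^sup>2)"
    using second not_integrable_integral_eq by fastforce
  let ?B = "\<lambda>\<omega>. 1 + s * ((X \<omega>)\<^sup>2 - 1) + s\<^sup>2 / t\<^sup>2 * (exp (2 * t) * ?Q \<omega>)"
  have dom: "exp (s * ((X \<omega>)\<^sup>2 - 1)) \<le> ?B \<omega>" for \<omega>
  proof -
    have "exp (2 * t * \<bar>(X \<omega>)\<^sup>2 - 1\<bar>) \<le> exp (2 * t * (1 + (X \<omega>)\<^sup>2))"
      using t by (simp add: abs_le_iff)
    also have "\<dots> = exp (2 * t) * ?Q \<omega>"
      by (simp add: exp_add[symmetric] t_def field_simps add_divide_distrib)
    finally have "s\<^sup>2 / t\<^sup>2 * exp (2 * t * \<bar>(X \<omega>)\<^sup>2 - 1\<bar>) \<le> s\<^sup>2 / t\<^sup>2 * (exp (2 * t) * ?Q \<omega>)"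
      by (rule mult_left_mono) simp
    with exp_le_quadratic_remainder[of s t "(X \<omega>)\<^sup>2 - 1"] s t show ?thesis
      by (simp add: t_def)
  qed
  have intB: "integrable M ?B" using int2 Q(1) by auto
  show integ: "integrable M (\<lambda>\<omega>. exp (s * ((X \<omega>)\<^sup>2 - 1)))"
    by (rule Bochner_Integration.integrable_bound[OF intB])
       (auto intro!: AE_I2 order_trans[OF dom])
  have "expectation (\<lambda>\<omega>. exp (s * ((X \<omega>)\<^sup>2 - 1))) \<le> expectation ?B"
    by (rule integral_mono[OF integ intB dom])
  also have "\<dots> = 1 + s\<^sup>2 / t\<^sup>2 * (exp (2 * t) * expectation ?Q)"
    using int2 Q(1) second by (simp add: prob_space)
  also have "\<dots> \<le> 1 + s\<^sup>2 / t\<^sup>2 * (exp (2 * t) * square_exp_const b)"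
    using Q(2) by (intro add_left_mono mult_left_mono) auto
  also have "\<dots> = 1 + mgf_rate b * s\<^sup>2"
    using b by (simp add: mgf_rate_def t_def field_simps eval_nat_numeral)
  also have "\<dots> \<le> exp (mgf_rate b * s\<^sup>2)" by simp
  finally show "expectation (\<lambda>\<omega>. exp (s * ((X \<omega>)\<^sup>2 - 1))) \<le> exp (mgf_rate b * s\<^sup>2)" .
qed

lemma mgf_rate_pos:
  assumes "b > 0"
  shows "mgf_rate b > 0"
proof -
  have "0 < (\<Sum>m::nat. exp (- (b\<^sup>2 / 2)) ^ (m\<^sup>2))"
    using assms by (intro suminf_pos summable_power_square) auto
  then show ?thesis using assms by (simp add: mgf_rate_def square_exp_const_def)
qed

section \<open>Chernoff bounds for sums\<close>

context prob_space
begin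

lemma chernoff_sum_upper:
  fixes Y :: "'i \<Rightarrow> 'a \<Rightarrow> real"
  assumes "finite I" and indep: "indep_vars (\<lambda>_. borel) Y I" and "s > 0"
    and int: "\<And>i. i \<in> I \<Longrightarrow> integrable M (\<lambda>\<omega>. exp (s * Y i \<omega>))"
    and mgf: "\<And>i. i \<in> I \<Longrightarrow> expectation (\<lambda>\<omega>. exp (s * Y i \<omega>)) \<le> exp L"
  shows "prob {\<omega> \<in> space M. (\<Sum>i\<in>I. Y i \<omega>) \<ge> a} \<le> exp (real (card I) * L - s * a)"
proof -
  have split: "exp (s * (\<Sum>i\<in>I. Y i \<omega>)) = (\<Prod>i\<in>I. exp (s * Y i \<omega>))" for \<omega>
    by (simp add: sum_distrib_left exp_sum \<open>finite I\<close>)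
  have ind: "indep_vars (\<lambda>_. borel) (\<lambda>i \<omega>. exp (s * Y i \<omega>)) I"
    by (rule indep_vars_compose2[OF indep]) simp
  have prodint: "integrable M (\<lambda>\<omega>. exp (s * (\<Sum>i\<in>I. Y i \<omega>)))"
    unfolding split by (rule indep_vars_integrable[OF \<open>finite I\<close> ind int])
  have "expectation (\<lambda>\<omega>. exp (s * (\<Sum>i\<in>I. Y i \<omega>)))
      = (\<Prod>i\<in>I. expectation (\<lambda>\<omega>. exp (s * Y i \<omega>)))"
    unfolding split by (rule indep_vars_lebesgue_integral[OF \<open>finite I\<close> ind int])
  also have "\<dots> \<le> (\<Prod>i\<in>I. exp L)" using mgf by (intro prod_mono) auto
  also have "\<dots> = exp (real (card I) * L)" by (simp add: exp_of_nat_mult)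
  finally have E: "expectation (\<lambda>\<omega>. exp (s * (\<Sum>i\<in>I. Y i \<omega>))) \<le> exp (real (card I) * L)" .
  have "prob {\<omega> \<in> space M. (\<Sum>i\<in>I. Y i \<omega>) \<ge> a}
      = prob {\<omega> \<in> space M. exp (s * (\<Sum>i\<in>I. Y i \<omega>)) \<ge> exp (s * a)}"
    using \<open>s > 0\<close> by simp
  also have "\<dots> \<le> expectation (\<lambda>\<omega>. exp (s * (\<Sum>i\<in>I. Y i \<omega>))) / exp (s * a)"
    by (rule integral_Markov_inequality_measure[OF prodint, of "{}"]) auto
  also have "\<dots> = exp (- s * a) * expectation (\<lambda>\<omega>. exp (s * (\<Sum>i\<in>I. Y i \<omega>)))"
    by (simp add: exp_minus divide_inverse mult.commute)
  also have "\<dots> \<le> exp (- s * a) * exp (real (card I) * L)"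
    using E by (rule mult_left_mono) simp
  also have "\<dots> = exp (real (card I) * L - s * a)" by (simp add: exp_add[symmetric])
  finally show ?thesis .
qed

text \<open>The one-sided bound with parameter \<open>s = \<eta> * x\<close> has exponent \<open>n * (K * \<eta>\<^sup>2 - \<eta>) * x\<^sup>2\<close>; taking
  \<open>K * \<eta> \<le> 1 / 2\<close> leaves at least half of the linear gain. The lower tail is the upper tail of the
  negated variables.\<close>

lemma chernoff_sum_two_sided:
  fixes Y :: "'i \<Rightarrow> 'a \<Rightarrow> real"
  assumes "finite I" and indep: "indep_vars (\<lambda>_. borel) Y I"
    and int: "\<And>i s. i \<in> I \<Longrightarrow> \<bar>s\<bar> \<le> t \<Longrightarrow> integrable M (\<lambda>\<omega>. exp (s * Y i \<omega>))"
    and mgf: "\<And>i s. i \<in> I \<Longrightarrow> \<bar>s\<bar> \<le> t \<Longrightarrow>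
      expectation (\<lambda>\<omega>. exp (s * Y i \<omega>)) \<le> exp (K * s\<^sup>2)"
    and "x > 0" "\<eta> > 0" "\<eta> * x \<le> t" "K * \<eta> \<le> 1 / 2"
  shows "prob {\<omega> \<in> space M. \<bar>\<Sum>i\<in>I. Y i \<omega>\<bar> > real (card I) * x}
    \<le> 2 * exp (- (real (card I) * (\<eta> / 2 * x\<^sup>2)))"
proof -
  let ?n = "real (card I)" and ?s = "\<eta> * x"
  have s: "?s > 0" "\<bar>?s\<bar> \<le> t" "\<bar>- ?s\<bar> \<le> t" using assms by auto
  have [measurable]: "Y i \<in> borel_measurable M" if "i \<in> I" for i
    using indep that by (simp add: indep_vars_def)
  have "(K * \<eta>) * (\<eta> * x\<^sup>2) \<le> 1 / 2 * (\<eta> * x\<^sup>2)"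
    using assms by (intro mult_right_mono) auto
  then have "K * ?s\<^sup>2 - ?s * x \<le> - (\<eta> / 2 * x\<^sup>2)"
    by (simp add: power2_eq_square algebra_simps)
  then have "?n * (K * ?s\<^sup>2 - ?s * x) \<le> ?n * - (\<eta> / 2 * x\<^sup>2)"
    by (rule mult_left_mono) simp
  then have expo: "?n * (K * ?s\<^sup>2) - ?s * (?n * x) \<le> - (?n * (\<eta> / 2 * x\<^sup>2))"
    by (simp add: algebra_simps)
  have up: "prob {\<omega> \<in> space M. (\<Sum>i\<in>I. Y i \<omega>) \<ge> ?n * x}
      \<le> exp (?n * (K * ?s\<^sup>2) - ?s * (?n * x))"
    by (rule chernoff_sum_upper[OF \<open>finite I\<close> indep s(1)]) (use int mgf s in auto)
  have lo: "prob {\<omega> \<in> space M. (\<Sum>i\<in>I. - Y i \<omega>) \<ge> ?n * x}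
      \<le> exp (?n * (K * ?s\<^sup>2) - ?s * (?n * x))"
  proof (rule chernoff_sum_upper[OF \<open>finite I\<close> _ s(1)])
    show "indep_vars (\<lambda>_. borel) (\<lambda>i \<omega>. - Y i \<omega>) I"
      by (rule indep_vars_compose2[OF indep]) simp
  next
    fix i assume "i \<in> I"
    from int[OF this s(3)] mgf[OF this s(3)]
    show "integrable M (\<lambda>\<omega>. exp (?s * - Y i \<omega>))"
      and "expectation (\<lambda>\<omega>. exp (?s * - Y i \<omega>)) \<le> exp (K * ?s\<^sup>2)"
      by simp_all
  qed
  have "prob {\<omega> \<in> space M. \<bar>\<Sum>i\<in>I. Y i \<omega>\<bar> > ?n * x}
      \<le> prob ({\<omega> \<in> space M. (\<Sum>i\<in>I. Y i \<omega>) \<ge> ?n * x}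
            \<union> {\<omega> \<in> space M. (\<Sum>i\<in>I. - Y i \<omega>) \<ge> ?n * x})"
    by (intro finite_measure_mono) (auto simp: sum_negf abs_if split: if_splits)
  also have "\<dots> \<le> prob {\<omega> \<in> space M. (\<Sum>i\<in>I. Y i \<omega>) \<ge> ?n * x}
      + prob {\<omega> \<in> space M. (\<Sum>i\<in>I. - Y i \<omega>) \<ge> ?n * x}"
    by (intro measure_Un_le) auto
  also have "\<dots> \<le> 2 * exp (?n * (K * ?s\<^sup>2) - ?s * (?n * x))"
    using up lo by simp
  also have "\<dots> \<le> 2 * exp (- (?n * (\<eta> / 2 * x\<^sup>2)))"
    using expo by simp
  finally show ?thesis .
qed

end

section \<open>The error of the randomized misfit\<close>

lemma rma_error_eq:
  fixes v :: "real ^ 'N"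
  assumes "d - F u = v" "v \<noteq> 0" "n > 0"
  shows "\<bar>rma_cost d F u\<^sub>0 C n \<rho> u - cost d F u\<^sub>0 C u\<bar>
    = (norm v)\<^sup>2 / (2 * real n) * \<bar>\<Sum>j=1..n. (\<rho> j \<bullet> sgn v)\<^sup>2 - 1\<bar>"
proof -
  have inner: "(\<rho> j \<bullet> v)\<^sup>2 = (norm v)\<^sup>2 * (\<rho> j \<bullet> sgn v)\<^sup>2" for j
    using \<open>v \<noteq> 0\<close> by (simp add: sgn_div_norm power_mult_distrib field_simps)
  have "rma_cost d F u\<^sub>0 C n \<rho> u - cost d F u\<^sub>0 C u
      = (norm v)\<^sup>2 / (2 * real n) * (\<Sum>j=1..n. (\<rho> j \<bullet> sgn v)\<^sup>2 - 1)"
    using \<open>n > 0\<close> unfolding rma_cost_def cost_def assms(1) inner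
    by (simp add: sum_subtractf sum_distrib_left[symmetric] field_simps)
  then show ?thesis by (simp add: abs_mult)
qed

text \<open>The draws enter only through the expectations of \<open>exp (s * ((r \<bullet> sgn v)\<^sup>2 - 1))\<close>, which depend on the
  common law alone, so the moment bounds for \<open>r\<close> hold for every draw.\<close>

lemma (in prob_space) rma_error_tail:
  fixes r :: "'a \<Rightarrow> real ^ 'N" and v :: "real ^ 'N"
  assumes r: "iid_standardized_components r" and sub: "\<And>i. subgaussian b (\<lambda>\<omega>. r \<omega> $ i)"
    and rs: "iid_draws r rs" and v: "d - F u = v" "v \<noteq> 0" and "n > 0" "\<delta> > 0"
    and \<eta>: "\<eta> > 0" "\<eta> * (\<delta> / (norm v)\<^sup>2) \<le> 1 / (8 * b\<^sup>2)" "mgf_rate b * \<eta> \<le> 1 / 2"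
  shows "prob {\<omega> \<in> space M.
      \<bar>rma_cost d F u\<^sub>0 C n (\<lambda>j. rs j \<omega>) u - cost d F u\<^sub>0 C u\<bar> > \<delta> / 2}
    \<le> 2 * exp (- (real n * (\<eta> / 2 * (\<delta> / (norm v)\<^sup>2)\<^sup>2)))"
proof -
  let ?X = "\<lambda>\<omega>. r \<omega> \<bullet> sgn v" and ?Y = "\<lambda>j \<omega>. (rs j \<omega> \<bullet> sgn v)\<^sup>2 - 1"
  have unit: "(\<Sum>i\<in>UNIV. (sgn v $ i)\<^sup>2) = 1"
    using v(2) norm_sgn[of v] by (simp add: norm_vec_def L2_set_def)
  have X_eq: "?X \<omega> = (\<Sum>i\<in>UNIV. sgn v $ i * r \<omega> $ i)" for \<omega>
    by (simp add: inner_vec_def mult.commute)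
  have rm [measurable]: "r \<in> borel_measurable M"
    using r by (simp add: iid_standardized_components_def)
  have subX: "subgaussian b ?X" unfolding X_eq
    by (rule subgaussian_linear_combination)
       (use r sub unit in \<open>auto simp: iid_standardized_components_def\<close>)
  have mean: "expectation (\<lambda>\<omega>. r \<omega> $ i) = 0"
    and var: "variance (\<lambda>\<omega>. r \<omega> $ i) = 1" for i
    using r unfolding iid_standardized_components_def by blast+
  have "expectation (\<lambda>\<omega>. (?X \<omega>)\<^sup>2) = (\<Sum>i\<in>UNIV. (sgn v $ i)\<^sup>2)" unfolding X_eq
  proof (rule expectation_square_linear_combination)
    show "expectation (\<lambda>\<omega>. (r \<omega> $ i)\<^sup>2) = 1" for i
      using var[of i] by (simp add: mean)
  qed (use r in \<open>auto simp: iid_standardized_components_def\<close>)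
  then have second: "expectation (\<lambda>\<omega>. (?X \<omega>)\<^sup>2) = 1" using unit by simp
  have indep: "indep_vars (\<lambda>_. borel) ?Y {1..n}"
    by (rule indep_vars_compose2[OF indep_vars_subset[where I="{1..}"]])
       (use rs in \<open>auto simp: iid_draws_def\<close>)
  have rsm [measurable]: "rs j \<in> borel_measurable M" if "j \<in> {1..n}" for j
    using rs that by (simp add: iid_draws_def indep_vars_def)
  have law: "distr M borel (rs j) = distr M borel r" if "j \<in> {1..n}" for j
    using rs that by (simp add: iid_draws_def)
  let ?f = "\<lambda>s (x :: real ^ 'N). exp (s * ((x \<bullet> sgn v)\<^sup>2 - 1))"
  have tr_int: "integrable M (\<lambda>\<omega>. exp (s * ?Y j \<omega>)) \<longleftrightarrow> integrable M (\<lambda>\<omega>. exp (s * ((?X \<omega>)\<^sup>2 - 1)))"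
    if "j \<in> {1..n}" for j s
    using integrable_distr_eq[OF rsm[OF that], of "?f s"] integrable_distr_eq[OF rm, of "?f s"]
      law[OF that] by simp
  have tr_exp: "expectation (\<lambda>\<omega>. exp (s * ?Y j \<omega>)) = expectation (\<lambda>\<omega>. exp (s * ((?X \<omega>)\<^sup>2 - 1)))"
    if "j \<in> {1..n}" for j s
    using integral_distr[OF rsm[OF that], of "?f s"] integral_distr[OF rm, of "?f s"]
      law[OF that] by simp
  have ev: "\<bar>rma_cost d F u\<^sub>0 C n (\<lambda>j. rs j \<omega>) u - cost d F u\<^sub>0 C u\<bar> > \<delta> / 2
      \<longleftrightarrow> \<bar>\<Sum>j=1..n. ?Y j \<omega>\<bar> > real (card {1..n}) * (\<delta> / (norm v)\<^sup>2)" for \<omega>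
    unfolding rma_error_eq[where F = F and u = u, OF v \<open>n > 0\<close>]
    using \<open>n > 0\<close> v(2) by (simp add: field_simps)
  show ?thesis unfolding ev
    using chernoff_sum_two_sided[of "{1..n}" ?Y "1 / (8 * b\<^sup>2)" "mgf_rate b" "\<delta> / (norm v)\<^sup>2" \<eta>]
      indep \<eta> \<open>\<delta> > 0\<close> v(2) centred_square_mgf[OF subX second]
    by (simp add: tr_int tr_exp)
qed

lemma eventually_absorb_constant_factor:
  fixes A c c' :: real
  assumes "c < c'" "A > 0"
  shows "\<forall>\<^sub>F n in sequentially. A * exp (- (real n * c')) \<le> exp (- (real n * c))"
proof -
  have "\<forall>\<^sub>F n in sequentially. real n \<ge> ln A / (c' - c)"
    using filterlim_real_sequentially by (simp add: filterlim_at_top)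
  then show ?thesis
  proof eventually_elim
    case (elim n)
    then have "ln A + - (real n * c') \<le> - (real n * c)"
      using assms by (simp add: field_simps)
    then have "exp (ln A + - (real n * c')) \<le> exp (- (real n * c))" by simp
    then show ?case using assms by (simp only: exp_add exp_ln)
  qed
qed

theorem theorem1:
  fixes b \<kappa> :: real
  assumes "b \<ge> 1 / sqrt 2" and "\<kappa> > 0"
  shows "\<exists>c. 0 < c \<and> c < 1 / (8 * b ^ 4) \<and>
    (\<forall>(M :: 'a measure) (r :: 'a \<Rightarrow> real ^ 'N) rs (d :: real ^ 'N)
        (F :: real ^ 'm \<Rightarrow> real ^ 'N) u\<^sub>0 C u.
      prob_space M \<longrightarrow> spd C \<longrightarrow>
      prob_space.iid_standardized_components M r \<longrightarrow>
      (\<forall>i. prob_space.subgaussian M b (\<lambda>\<omega>. r \<omega> $ i)) \<longrightarrow>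
      prob_space.iid_draws M r rs \<longrightarrow>
      (let v = d - F u; \<theta> = (norm v)\<^sup>2 / sqrt 2 in
        \<exists>I. prob_space.has_large_deviation_rate M
              (\<lambda>n \<omega>. \<bar>rma_cost d F u\<^sub>0 C n (\<lambda>j. rs j \<omega>) u - cost d F u\<^sub>0 C u\<bar>) I \<and>
            (\<forall>\<delta>. 0 < \<delta> \<and> \<delta> \<le> \<kappa> * \<theta> \<longrightarrow> c * (\<delta>\<^sup>2 / (2 * \<theta>\<^sup>2)) \<le> I \<delta>)))"
proof -
  have b: "b > 0" using assms(1) by (rule less_le_trans[rotated]) simp
  (* The first bound keeps \<eta> * x below 1 / (8 * b^2) for all x up to \<kappa> / sqrt 2; the second gives
     mgf_rate b * \<eta> \<le> 1 / 2. *)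
  define \<eta> where "\<eta> = min (sqrt 2 / (8 * b\<^sup>2 * \<kappa>)) (1 / (2 * mgf_rate b))"
  (* strictly below \<eta> / 2, to leave room for absorbing the factor 2 of the two-sided bound *)
  define c where "c = min (\<eta> / 4) (1 / (16 * b ^ 4))"
  have K: "mgf_rate b > 0" by (rule mgf_rate_pos[OF b])
  have \<eta>: "\<eta> > 0" using b K \<open>\<kappa> > 0\<close> by (simp add: \<eta>_def)
  have \<eta>1: "mgf_rate b * \<eta> \<le> 1 / 2"
  proof -
    have "mgf_rate b * \<eta> \<le> mgf_rate b * (1 / (2 * mgf_rate b))"
      using K by (intro mult_left_mono) (auto simp: \<eta>_def)
    then show ?thesis using K by simp
  qed
  have c: "0 < c" "c < \<eta> / 2" using \<eta> b by (auto simp: c_def)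
  have "c \<le> 1 / (16 * b ^ 4)" by (simp add: c_def)
  also have "\<dots> < 1 / (8 * b ^ 4)" using b by (simp add: field_simps)
  finally have c8: "c < 1 / (8 * b ^ 4)" .
  show ?thesis
  proof (rule exI[of _ c], intro conjI allI impI c(1) c8, unfold Let_def)
    fix M :: "'a measure" and r :: "'a \<Rightarrow> real ^ 'N" and rs and d :: "real ^ 'N"
      and F :: "real ^ 'm \<Rightarrow> real ^ 'N" and u\<^sub>0 C u
    assume M: "prob_space M" and r: "prob_space.iid_standardized_components M r"
      and sub: "\<forall>i. prob_space.subgaussian M b (\<lambda>\<omega>. r \<omega> $ i)"
      and rs: "prob_space.iid_draws M r rs"
    interpret prob_space M by (rule M)
    have sub': "subgaussian b (\<lambda>\<omega>. r \<omega> $ i)" for i using sub by blast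
    define v where "v = d - F u"
    define \<theta> where "\<theta> = (norm v)\<^sup>2 / sqrt 2"
    (* outside the prescribed range of \<delta> the rate 0 is valid because probabilities are at most 1 *)
    define I where "I \<delta> = (if \<delta> \<le> \<kappa> * \<theta> then c * (\<delta>\<^sup>2 / (2 * \<theta>\<^sup>2)) else 0)" for \<delta>
    let ?E = "\<lambda>n \<omega>. \<bar>rma_cost d F u\<^sub>0 C n (\<lambda>j. rs j \<omega>) u - cost d F u\<^sub>0 C u\<bar>"
    have "has_large_deviation_rate ?E I"
      unfolding has_large_deviation_rate_def
    proof (intro allI impI)
      fix \<delta> :: real assume \<delta>: "\<delta> > 0"
      show "\<forall>\<^sub>F n in sequentially.
          prob {\<omega> \<in> space M. ?E n \<omega> > \<delta> / 2} \<le> exp (- (real n * I \<delta>))"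
      proof (cases "\<delta> \<le> \<kappa> * \<theta>")
        case False
        then show ?thesis by (simp add: I_def)
      next
        case True
        with \<delta> have v0: "v \<noteq> 0" by (auto simp: \<theta>_def)
        let ?x = "\<delta> / (norm v)\<^sup>2"
        have I: "I \<delta> = c * ?x\<^sup>2"
          using True by (simp add: I_def \<theta>_def power_divide)
        have "?x \<le> \<kappa> / sqrt 2"
          using True v0 by (simp add: \<theta>_def field_simps)
        then have "\<eta> * ?x \<le> (sqrt 2 / (8 * b\<^sup>2 * \<kappa>)) * (\<kappa> / sqrt 2)"
          using \<eta> \<delta> \<open>\<kappa> > 0\<close> by (intro mult_mono) (auto simp: \<eta>_def)
        also have "\<dots> = 1 / (8 * b\<^sup>2)" using \<open>\<kappa> > 0\<close> by simp
        finally have \<eta>x: "\<eta> * ?x \<le> 1 / (8 * b\<^sup>2)" .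
        have "c * ?x\<^sup>2 < \<eta> / 2 * ?x\<^sup>2"
          using c(2) \<delta> v0 by (intro mult_strict_right_mono) auto
        then have "\<forall>\<^sub>F n in sequentially.
            2 * exp (- (real n * (\<eta> / 2 * ?x\<^sup>2))) \<le> exp (- (real n * I \<delta>))"
          unfolding I by (rule eventually_absorb_constant_factor) simp
        with eventually_gt_at_top[of 0] show ?thesis
        proof eventually_elim
          case (elim n)
          have "prob {\<omega> \<in> space M. ?E n \<omega> > \<delta> / 2} \<le> 2 * exp (- (real n * (\<eta> / 2 * ?x\<^sup>2)))"
            by (rule rma_error_tail[where d = d and F = F and u = u,
                OF r sub' rs v_def[symmetric] v0 elim(1) \<delta> \<eta> \<eta>x \<eta>1])
          with elim(2) show ?case by linarith
        qed
      qed
    qed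
    then show "\<exists>I. has_large_deviation_rate ?E I \<and>
        (\<forall>\<delta>. 0 < \<delta> \<and> \<delta> \<le> \<kappa> * ((norm (d - F u))\<^sup>2 / sqrt 2) \<longrightarrow>
          c * (\<delta>\<^sup>2 / (2 * ((norm (d - F u))\<^sup>2 / sqrt 2)\<^sup>2)) \<le> I \<delta>)"
      by (intro exI[of _ I]) (simp add: I_def \<theta>_def v_def)
  qed
qed

end
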